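(* Let $p$ be an odd prime and let $A$ be the ring of degree zero stable operations in $p$-local complex $K$-theory (described in the context). An $A$-module $M$ is discrete if and only if it is locally finitely generated, i.e. if and only if for every $x\in M$ the submodule $Ax$ is finitely generated over $\mathbb{Z}_{(p)}$.
   Context: $\mathbb{Z}_{(p)}$ denotes the integers localized at $p$. Let $A=K^0_{(p)}(K_{(p)})$ be the ring of degree zero stable operations in $p$-local complex $K$-theory. Fix an integer $q$ primitive modulo $p^2$ and let $\Psi^q\in A$ be the Adams operation. Put $q_i=q^{(-1)^i\lfloor i/2\rfloor}$ for $i\ge1$, $\Theta_n(X)=\prod_{i=1}^n(X-q_i)\in\mathbb{Z}_{(p)}[X]$, and $\Phi_n=\Theta_n(\Psi^q)\in A$ ($\Phi_0=1$). Every element of $A$ can be written uniquely as a convergent infinite sum $\sum_{n\ge0}a_n\Phi_n$ with $a_n\in\mathbb{Z}_{(p)}$. For $m\ge0$ let $A_m=\{\sum_{n\ge m}a_n\Phi_n : a_n\in\mathbb{Z}_{(p)}\}$, a decreasing chain of ideals; $A$ is given the topology whose open sets are unions of cosets $y+A_m$. An $A$-module $M$ is called discrete if the action map $A\times M\to M$ is continuous for the discrete topology on $M$ and the product topology on $A\times M$; equivalently, for each $x\in M$ there is $n$ with $A_nx=0$. *)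

theory Defs
  imports "HOL-Algebra.Module" "HOL-Computational_Algebra.Polynomial"
begin

definition Zloc :: "nat \<Rightarrow> rat set" where
  "Zloc p = {x. \<not> (int p dvd snd (quotient_of x))}"

definition primitive_mod_sq :: "nat \<Rightarrow> int \<Rightarrow> bool" where
  "primitive_mod_sq p q \<longleftrightarrow> coprime q (int p) \<and>
     (\<forall>k. 0 < k \<and> k < p * (p - 1) \<longrightarrow> q ^ k mod (int p ^ 2) \<noteq> 1)"

definition qseq :: "int \<Rightarrow> nat \<Rightarrow> rat" where
  "qseq q i = (if even i then (of_int q) ^ (i div 2) else inverse ((of_int q) ^ (i div 2)))"

definition Theta :: "int \<Rightarrow> nat \<Rightarrow> rat poly" where
  "Theta q n = (\<Prod>i\<in>{1..n}. [:- qseq q i, 1:])"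

definition theta_coords :: "int \<Rightarrow> rat poly \<Rightarrow> nat \<Rightarrow> rat" where
  "theta_coords q f = (THE c. (\<forall>k>degree f. c k = 0) \<and>
       f = (\<Sum>k\<le>degree f. smult (c k) (Theta q k)))"

text \<open>The ring A: an element sum_n a_n Phi_n is represented by its coefficient
  sequence a; Phi_m Phi_n = Theta_m(Psi^q) Theta_n(Psi^q) is expanded in the Phi basis.\<close>
definition A_mult :: "int \<Rightarrow> (nat \<Rightarrow> rat) \<Rightarrow> (nat \<Rightarrow> rat) \<Rightarrow> nat \<Rightarrow> rat" where
  "A_mult q a b k = (\<Sum>m\<le>k. \<Sum>n\<le>k. a m * b n * theta_coords q (Theta q m * Theta q n) k)"

definition A_ring :: "nat \<Rightarrow> int \<Rightarrow> (nat \<Rightarrow> rat) ring" where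
  "A_ring p q = \<lparr> partial_object.carrier = {a. \<forall>n. a n \<in> Zloc p},
                 monoid.mult = A_mult q,
                 monoid.one = (\<lambda>n. if n = 0 then 1 else 0),
                 ring.zero = (\<lambda>n. 0),
                 ring.add = (\<lambda>a b n. a n + b n) \<rparr>"

definition A_ideal :: "nat \<Rightarrow> int \<Rightarrow> nat \<Rightarrow> (nat \<Rightarrow> rat) set" where
  "A_ideal p q m = {a \<in> carrier (A_ring p q). \<forall>k<m. a k = 0}"

text \<open>Discrete module (equivalent form from the context): every element is
  annihilated by some A_n.\<close>
definition discrete_mod :: "nat \<Rightarrow> int \<Rightarrow> ((nat \<Rightarrow> rat), 'b) module \<Rightarrow> bool" where
  "discrete_mod p q M \<longleftrightarrow> (\<forall>x\<in>carrier M. \<exists>n. \<forall>a\<in>A_ideal p q n. a \<odot>\<^bsub>M\<^esub> x = \<zero>\<^bsub>M\<^esub>)"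

text \<open>Z_(p) acts through the unit map r \<mapsto> r Phi_0.\<close>
definition A_const :: "rat \<Rightarrow> nat \<Rightarrow> rat" where
  "A_const r = (\<lambda>n. if n = 0 then r else 0)"

definition cyclic_sub :: "nat \<Rightarrow> int \<Rightarrow> ((nat \<Rightarrow> rat), 'b) module \<Rightarrow> 'b \<Rightarrow> 'b set" where
  "cyclic_sub p q M x = {a \<odot>\<^bsub>M\<^esub> x | a. a \<in> carrier (A_ring p q)}"

definition locally_fg :: "nat \<Rightarrow> int \<Rightarrow> ((nat \<Rightarrow> rat), 'b) module \<Rightarrow> bool" where
  "locally_fg p q M \<longleftrightarrow> (\<forall>x\<in>carrier M. \<exists>S. finite S \<and> S \<subseteq> cyclic_sub p q M x \<and>
      cyclic_sub p q M x =
        {finsum M (\<lambda>s. A_const (c s) \<odot>\<^bsub>M\<^esub> s) S | c. c \<in> S \<rightarrow> Zloc p})"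

end

theory Submission
  imports Defs "HOL-Number_Theory.Residues" "HOL-Library.Countable_Set"
begin

text \<open>If \<open>A_n x = 0\<close>, then \<open>Phi_0 x, ..., Phi_(n-1) x\<close> span \<open>Ax\<close> over \<open>Z_(p)\<close>. Conversely, let \<open>Ax\<close> be
  finitely generated over \<open>Z_(p)\<close>. Then \<open>Ax / p ^ e Ax\<close> is finite for each \<open>e\<close>, which forces some
  \<open>A_m x\<close> into \<open>p ^ e Ax\<close>, so that \<open>a \<mapsto> ax\<close> is continuous for the p-adic topology on \<open>Ax\<close>, and this
  topology is separated by Krull's theorem. Since \<open>Z_(p)\<close> is countable, so is \<open>Ax\<close>; but if no \<open>A_n\<close>
  annihilated \<open>x\<close>, suitable infinite sums would give uncountably many elements of \<open>Ax\<close>.\<close>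

text \<open>The action of \<open>A\<close> on \<open>M\<close> is not assumed to respect infinite
  sums, so nothing may be evaluated termwise on \<open>x\<close>. Every infinite sum is therefore a
  single coefficient sequence, and only finite identities in \<open>A\<close> are applied to
  \<open>x\<close>. Congruences modulo p^e are such identities, since a sequence with all
  coefficients divisible by p^e is p^e times an element of \<open>A\<close>; they control A_m
  because q_i is periodic in i modulo p^e. Countability is what separates Z_(p) from its completion:
  over the p-adic integers, sending Psi^q to a p-adic unit that is not an integer power of q gives a
  convergent evaluation, which makes the coefficient ring a finitely generated module in which no
  A_n annihilates 1.\<close>

section \<open>The ring Z_(p) and its ideals p^e Z_(p)\<close>

text \<open>The definition inspects the reduced denominator, whereas arithmetic produces unreduced
  and possibly negative ones. The reduced denominator divides every other, so primality to p
  descends to it.\<close>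

lemma Zloc_iff:
  assumes "prime p"
  shows "x \<in> Zloc p \<longleftrightarrow> (\<exists>a b. x = of_int a / of_int b \<and> \<not> int p dvd b)"
proof
  assume "x \<in> Zloc p"
  moreover obtain a b where "quotient_of x = (a, b)" by force
  ultimately show "\<exists>a b. x = of_int a / of_int b \<and> \<not> int p dvd b"
    using quotient_of_div[of x a b] by (simp add: Zloc_def) blast
next
  assume "\<exists>a b. x = of_int a / of_int b \<and> \<not> int p dvd b"
  then obtain a b where ab: "x = of_int a / of_int b" "\<not> int p dvd b" by blast
  obtain c d where cd: "quotient_of x = (c, d)" by force
  have d: "d > 0" "coprime c d" "x = of_int c / of_int d"
    using quotient_of_denom_pos[OF cd] quotient_of_coprime[OF cd] quotient_of_div[OF cd] by auto
  have "b \<noteq> 0" using ab by auto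
  then have "(of_int (c * b) :: rat) = of_int (a * d)"
    using d ab by (simp add: field_simps)
  then have "d dvd c * b" by (metis dvd_triv_right of_int_eq_iff)
  then have "d dvd b"
    using d(2) by (simp add: coprime_commute coprime_dvd_mult_right_iff)
  with ab(2) have "\<not> int p dvd d" using dvd_trans by blast
  then show "x \<in> Zloc p" by (simp add: Zloc_def cd)
qed

lemma Zloc_of_int: "prime p \<Longrightarrow> of_int a \<in> Zloc p"
  by (subst Zloc_iff, assumption, intro exI[of _ a] exI[of _ 1]) (auto simp: prime_nat_iff)

lemma Zloc_0: "prime p \<Longrightarrow> 0 \<in> Zloc p" and Zloc_1: "prime p \<Longrightarrow> 1 \<in> Zloc p"
  using Zloc_of_int[of p 0] Zloc_of_int[of p 1] by auto

lemma Zloc_of_nat_power: "prime p \<Longrightarrow> of_nat p ^ e \<in> Zloc p"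
  using Zloc_of_int[of p "int p ^ e"] by simp

lemma Zloc_mult:
  assumes "prime p" "x \<in> Zloc p" "y \<in> Zloc p"
  shows "x * y \<in> Zloc p"
proof -
  obtain a b c d where "x = of_int a / of_int b" "\<not> int p dvd b"
      "y = of_int c / of_int d" "\<not> int p dvd d"
    using assms unfolding Zloc_iff[OF assms(1)] by blast
  then show ?thesis
    unfolding Zloc_iff[OF assms(1)] using assms(1)
    by (intro exI[of _ "a * c"] exI[of _ "b * d"]) (auto simp: prime_dvd_mult_iff)
qed

lemma Zloc_add:
  assumes "prime p" "x \<in> Zloc p" "y \<in> Zloc p"
  shows "x + y \<in> Zloc p"
proof -
  obtain a b c d where *: "x = of_int a / of_int b" "\<not> int p dvd b"
      "y = of_int c / of_int d" "\<not> int p dvd d"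
    using assms unfolding Zloc_iff[OF assms(1)] by blast
  then have "b \<noteq> 0" "d \<noteq> 0" by auto
  then have "x + y = of_int (a * d + c * b) / of_int (b * d)"
    using * by (simp add: field_simps)
  moreover have "\<not> int p dvd b * d" using * assms(1) by (auto simp: prime_dvd_mult_iff)
  ultimately show ?thesis unfolding Zloc_iff[OF assms(1)] by blast
qed

lemma Zloc_uminus: "prime p \<Longrightarrow> x \<in> Zloc p \<Longrightarrow> - x \<in> Zloc p"
  using Zloc_mult[of p "-1" x] Zloc_of_int[of p "-1"] by simp

lemma Zloc_diff: "prime p \<Longrightarrow> x \<in> Zloc p \<Longrightarrow> y \<in> Zloc p \<Longrightarrow> x - y \<in> Zloc p"
  using Zloc_add[of p x "- y"] Zloc_uminus[of p y] by simp

lemma Zloc_inverse_of_int: "prime p \<Longrightarrow> \<not> int p dvd b \<Longrightarrow> inverse (of_int b) \<in> Zloc p"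
  by (subst Zloc_iff, assumption, intro exI[of _ 1] exI[of _ b]) (auto simp: field_simps)

text \<open>The discrete valuation property: \<open>k\<close> is the valuation of the numerator and
  \<open>d\<close> the inverse of the unit part of \<open>c\<close>.\<close>

lemma Zloc_dvd_power:
  assumes "prime p" "c \<in> Zloc p" "c \<noteq> 0"
  obtains k d where "d \<in> Zloc p" "of_nat p ^ k = d * c"
proof -
  obtain a b where ab: "c = of_int a / of_int b" "\<not> int p dvd b"
    using assms unfolding Zloc_iff[OF assms(1)] by blast
  have nz: "a \<noteq> 0" "b \<noteq> 0" using ab assms by auto
  have "\<not> is_unit (int p)" using assms(1) by (auto simp: prime_nat_iff)
  with nz(1) obtain k a' where a': "a = int p ^ k * a'" "\<not> int p dvd a'"
    by (metis multiplicity_decompose')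
  have "of_int b / of_int a' \<in> Zloc p"
    unfolding Zloc_iff[OF assms(1)] using a' by blast
  moreover have "of_nat p ^ k = of_int b / of_int a' * c"
    using a' nz by (auto simp: ab field_simps)
  ultimately show thesis by (rule that)
qed

lemma Zloc_p_not_unit: "prime p \<Longrightarrow> d \<in> Zloc p \<Longrightarrow> of_nat p * d \<noteq> 1"
proof
  assume p: "prime p" "d \<in> Zloc p" "of_nat p * d = 1"
  then obtain a b where ab: "d = of_int a / of_int b" "\<not> int p dvd b"
    unfolding Zloc_iff[OF p(1)] by blast
  then have "b \<noteq> 0" by auto
  then have "(of_int (int p * a) :: rat) = of_int b" using p ab by (simp add: field_simps)
  then have "int p * a = b" by (simp only: of_int_eq_iff)
  with ab show False by auto
qed

text \<open>Z_(p)/p^e is Z/p^e, because a denominator prime to p is invertible modulo p^e;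
  \<open>r\<close> is the numerator times that inverse.\<close>

lemma Zloc_residue:
  assumes "prime p" "c \<in> Zloc p"
  obtains r :: int and d where "0 \<le> r" "r < int p ^ e" "d \<in> Zloc p" "c = of_int r + of_nat p ^ e * d"
proof -
  obtain a b where ab: "c = of_int a / of_int b" "\<not> int p dvd b"
    using assms unfolding Zloc_iff[OF assms(1)] by blast
  have "coprime b (int p ^ e)"
    using ab(2) assms(1)
    by (metis coprime_commute coprime_power_right_iff prime_imp_coprime prime_nat_int_transfer)
  then obtain b' where b': "[b * b' = 1] (mod int p ^ e)"
    using cong_solve_coprime_int by blast
  define r where "r = (a * b') mod int p ^ e"
  have "[b * r = a * (b * b')] (mod int p ^ e)"
    unfolding r_def by (simp add: cong_def mod_mult_right_eq mult_ac)
  also have "[a * (b * b') = a * 1] (mod int p ^ e)"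
    using b' by (rule cong_scalar_left)
  finally have "int p ^ e dvd a - b * r"
    by (simp add: cong_iff_dvd_diff dvd_diff_commute)
  then obtain h where h: "a - b * r = int p ^ e * h" by (rule dvdE)
  have "b \<noteq> 0" using ab by auto
  have "a = b * r + int p ^ e * h" using h by simp
  then have "c = of_int r + of_nat p ^ e * (of_int h / of_int b)"
    using \<open>b \<noteq> 0\<close> by (simp add: ab(1) field_simps)
  moreover have "of_int h / of_int b \<in> Zloc p"
    unfolding Zloc_iff[OF assms(1)] using ab(2) by blast
  moreover have "0 \<le> r" "r < int p ^ e"
    using assms(1) by (simp_all add: r_def prime_gt_0_nat)
  ultimately show thesis using that by blast
qed

text \<open>Exponent 0 gives \<open>Zloc p\<close> itself, so the closure lemmas for these ideals
  also serve for integrality.\<close>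

definition Zideal :: "nat \<Rightarrow> nat \<Rightarrow> rat set" where
  "Zideal p e = (\<lambda>z. of_nat p ^ e * z) ` Zloc p"

lemma Zideal_zero_exp: "Zideal p 0 = Zloc p"
  by (simp add: Zideal_def)

lemma Zideal_0: "prime p \<Longrightarrow> 0 \<in> Zideal p e"
  unfolding Zideal_def using Zloc_0[of p] by (metis image_eqI mult_zero_right)

lemma Zideal_add: "prime p \<Longrightarrow> x \<in> Zideal p e \<Longrightarrow> y \<in> Zideal p e \<Longrightarrow> x + y \<in> Zideal p e"
  unfolding Zideal_def using Zloc_add[of p] by (auto simp: image_iff simp flip: distrib_left)

lemma Zideal_mult: "prime p \<Longrightarrow> x \<in> Zloc p \<Longrightarrow> y \<in> Zideal p e \<Longrightarrow> x * y \<in> Zideal p e"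
  unfolding Zideal_def using Zloc_mult[of p x] by (auto simp: image_iff mult.left_commute)

lemma Zideal_uminus: "prime p \<Longrightarrow> x \<in> Zideal p e \<Longrightarrow> - x \<in> Zideal p e"
  using Zideal_mult[of p "-1" x] Zloc_of_int[of p "-1"] by simp

lemma Zideal_diff: "prime p \<Longrightarrow> x \<in> Zideal p e \<Longrightarrow> y \<in> Zideal p e \<Longrightarrow> x - y \<in> Zideal p e"
  using Zideal_add[of p x e "- y"] Zideal_uminus[of p y] by simp

lemma Zideal_sum: "prime p \<Longrightarrow> (\<And>i. i \<in> I \<Longrightarrow> f i \<in> Zideal p e) \<Longrightarrow> sum f I \<in> Zideal p e"
  by (induction I rule: infinite_finite_induct) (auto simp: Zideal_0 Zideal_add)

lemma Zideal_of_int: "prime p \<Longrightarrow> int p ^ e dvd a \<Longrightarrow> of_int a \<in> Zideal p e"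
  unfolding Zideal_def using Zloc_of_int by (auto elim!: dvdE)

section \<open>The sequence q_i modulo p^e\<close>

lemma qseq_in_Zloc:
  assumes "prime p" "coprime q (int p)"
  shows "qseq q i \<in> Zloc p"
proof -
  have "\<not> int p dvd q ^ n" for n
  proof
    assume "int p dvd q ^ n"
    then have "int p dvd q" using assms(1) by (simp add: prime_dvd_power)
    then have "is_unit (int p)" using assms(2) by (metis coprime_common_divisor dvd_refl)
    then show False using assms(1) by (auto simp: prime_nat_iff)
  qed
  then show ?thesis
    using Zloc_of_int[OF assms(1), of "q ^ (i div 2)"]
      Zloc_inverse_of_int[OF assms(1), of "q ^ (i div 2)"] by (simp add: qseq_def)
qed

text \<open>By Euler's theorem q^T is 1 modulo p^e for T the totient of p^e. Raising the index by 2T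
  keeps its parity and moves the exponent of q by T, up or down.\<close>

lemma qseq_period:
  assumes "prime p" "coprime q (int p)"
  obtains P where "P > 0" "\<And>i. qseq q (P + i) - qseq q i \<in> Zideal p e"
proof -
  define T where "T = totient (p ^ e)"
  have "T > 0" using assms(1) by (simp add: T_def prime_gt_0_nat)
  have "q ^ T mod int (p ^ e) = 1 mod int (p ^ e)"
  proof -
    define r where "r = nat (q mod int (p ^ e))"
    have r: "int r = q mod int (p ^ e)"
      using assms(1) by (simp add: r_def prime_gt_0_nat)
    have "coprime (int r) (int (p ^ e))"
    proof -
      have "coprime q (int (p ^ e))" "int (p ^ e) \<noteq> 0"
        using assms by (auto simp: prime_gt_0_nat)
      then show ?thesis
        unfolding r using coprime_mod_left_iff[of "int (p ^ e)" q] by blast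
    qed
    then have "[r ^ T = 1] (mod p ^ e)"
      unfolding T_def by (intro euler_theorem) (simp only: coprime_int_iff)
    then have "[int r ^ T = 1] (mod int (p ^ e))"
      by (metis cong_int_iff of_nat_1 of_nat_power)
    then show ?thesis by (simp add: r cong_def power_mod)
  qed
  then have dvd: "int p ^ e dvd q ^ T - 1" by (simp add: mod_eq_dvd_iff)
  have nz: "(of_int q :: rat) \<noteq> 0"
    using assms by auto
  have "qseq q (2 * T + i) - qseq q i \<in> Zideal p e" for i
  proof (cases "even i")
    case True
    then have "qseq q (2 * T + i) - qseq q i = qseq q i * of_int (q ^ T - 1)"
      by (simp add: qseq_def power_add algebra_simps)
    then show ?thesis
      using Zideal_mult[OF assms(1) qseq_in_Zloc[OF assms] Zideal_of_int[OF assms(1) dvd]]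
      by simp
  next
    case False
    then have "qseq q (2 * T + i) - qseq q i = - qseq q (2 * T + i) * of_int (q ^ T - 1)"
      using nz by (simp add: qseq_def power_add field_simps)
    then show ?thesis
      using Zideal_mult[OF assms(1) Zloc_uminus[OF assms(1) qseq_in_Zloc[OF assms]]
          Zideal_of_int[OF assms(1) dvd]] by (simp only:)
  qed
  with \<open>T > 0\<close> show thesis by (intro that[of "2 * T"]) auto
qed

section \<open>The basis Theta_n and coordinates in it\<close>

lemma Theta_0: "Theta q 0 = 1"
  by (simp add: Theta_def)

lemma Theta_Suc: "Theta q (Suc n) = Theta q n * [:- qseq q (Suc n), 1:]"
  by (simp add: Theta_def)

lemma monic_Theta: "lead_coeff (Theta q n) = 1"
  by (induction n) (simp_all add: Theta_0 Theta_Suc lead_coeff_mult del: mult_pCons_right)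

lemma degree_Theta: "degree (Theta q n) = n"
proof (induction n)
  case (Suc n)
  have "Theta q n \<noteq> 0" using monic_Theta[of q n] by auto
  with Suc show ?case unfolding Theta_Suc by (subst degree_mult_eq) auto
qed (simp add: Theta_0)

lemma coeff_Theta_self: "poly.coeff (Theta q n) n = 1"
  using monic_Theta[of q n] by (simp add: degree_Theta)

lemma coeff_Theta_above: "n < k \<Longrightarrow> poly.coeff (Theta q n) k = 0"
  by (simp add: coeff_eq_0 degree_Theta)

text \<open>The system is triangular: \<open>Theta q k\<close> is monic of degree k, so the
  coefficient of highest degree isolates \<open>c (Suc d)\<close>.\<close>

lemma Theta_combination_eq_0:
  assumes "(\<Sum>k\<le>d. smult (c k) (Theta q k)) = 0" "k \<le> d"
  shows "c k = 0"
  using assms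
proof (induction d arbitrary: k)
  case 0
  then show ?case by (simp add: Theta_0)
next
  case (Suc d)
  have "poly.coeff (\<Sum>k\<le>Suc d. smult (c k) (Theta q k)) (Suc d) = c (Suc d)"
    by (simp add: coeff_sum coeff_Theta_above coeff_Theta_self)
  with Suc.prems have "c (Suc d) = 0" by simp
  with Suc show ?case by (cases "k = Suc d") auto
qed

lemma degree_le_if_coeff_eq_0: "degree (f :: rat poly) \<le> Suc d \<Longrightarrow> poly.coeff f (Suc d) = 0 \<Longrightarrow> degree f \<le> d"
  using leading_coeff_0_iff[of f] by (cases "degree f = Suc d") auto

definition poly_in :: "rat set \<Rightarrow> rat poly \<Rightarrow> bool" where
  "poly_in I f \<longleftrightarrow> (\<forall>n. poly.coeff f n \<in> I)"

lemma poly_in_mult: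
  assumes "prime p" "poly_in (Zloc p) f" "poly_in (Zideal p e) g"
  shows "poly_in (Zideal p e) (f * g)"
  using assms unfolding poly_in_def coeff_mult by (auto intro!: Zideal_sum Zideal_mult)

lemma poly_in_Theta:
  assumes "prime p" "coprime q (int p)"
  shows "poly_in (Zloc p) (Theta q n)"
proof (induction n)
  case 0
  then show ?case using assms by (auto simp: poly_in_def Theta_0 coeff_1 Zloc_0 Zloc_1)
next
  case (Suc n)
  have "poly_in (Zloc p) [:- qseq q (Suc n), 1:]"
    using assms by (auto simp: poly_in_def coeff_pCons Zloc_0 Zloc_1 Zloc_uminus qseq_in_Zloc
        split: nat.split)
  with Suc show ?case
    unfolding Theta_Suc using poly_in_mult[OF assms(1), of _ 0] by (simp only: Zideal_zero_exp)
qed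

text \<open>Splitting off multiples of monic polynomials of descending degree requires no division,
  so divisibility by p^e passes from the coefficients of \<open>f\<close> to its
  coordinates.\<close>

lemma Theta_expansion:
  assumes "prime p" "coprime q (int p)" "poly_in (Zideal p e) f" "degree f \<le> d"
  obtains c where "\<And>k. c k \<in> Zideal p e" "\<And>k. k > d \<Longrightarrow> c k = 0"
    "f = (\<Sum>k\<le>d. smult (c k) (Theta q k))"
proof -
  have "\<exists>c. (\<forall>k. c k \<in> Zideal p e) \<and> (\<forall>k>d. c k = 0) \<and> f = (\<Sum>k\<le>d. smult (c k) (Theta q k))"
    using assms(3,4)
  proof (induction d arbitrary: f)
    case 0
    then have "f = [:poly.coeff f 0:]" by (metis degree_eq_zeroE coeff_pCons_0 le_0_eq)
    then show ?case using 0 Zideal_0[OF assms(1)]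
      by (intro exI[of _ "\<lambda>k. if k = 0 then poly.coeff f 0 else 0"]) (auto simp: Theta_0 poly_in_def)
  next
    case (Suc d)
    define r where "r = poly.coeff f (Suc d)"
    define g where "g = f - smult r (Theta q (Suc d))"
    have r: "r \<in> Zideal p e" using Suc.prems by (simp add: r_def poly_in_def)
    have "poly_in (Zideal p e) g"
      using Suc.prems(1) r poly_in_Theta[OF assms(1,2), of "Suc d"] assms(1)
      by (auto simp: g_def poly_in_def intro!: Zideal_diff)
         (simp add: Zideal_mult mult.commute[of r])
    moreover have "degree g \<le> d"
    proof (rule degree_le_if_coeff_eq_0)
      show "degree g \<le> Suc d"
        unfolding g_def using Suc.prems(2)
        by (intro degree_diff_le) (auto simp: degree_Theta intro: order_trans[OF degree_smult_le])
      show "poly.coeff g (Suc d) = 0" by (simp add: g_def r_def coeff_Theta_self)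
    qed
    ultimately obtain c where c: "\<forall>k. c k \<in> Zideal p e" "\<forall>k>d. c k = 0"
        "g = (\<Sum>k\<le>d. smult (c k) (Theta q k))"
      using Suc.IH by blast
    have "f = g + smult r (Theta q (Suc d))" by (simp add: g_def)
    then show ?case using c r
      by (intro exI[of _ "c(Suc d := r)"]) auto
  qed
  then show thesis using that by blast
qed

text \<open>\<open>theta_coords\<close> bounds the support by \<open>degree f\<close>, while
  expansions arise with some other bound \<open>d\<close>. The point is that cancellation cannot
  hide a nonzero coordinate above the degree.\<close>

lemma theta_coords_eqI:
  assumes "\<And>k. k > d \<Longrightarrow> c k = 0" "f = (\<Sum>k\<le>d. smult (c k) (Theta q k))"
  shows "theta_coords q f = c"
proof -
  have deg: "degree f \<le> d"
    unfolding assms(2)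
    by (intro degree_sum_le) (auto simp: degree_Theta intro: order_trans[OF degree_smult_le])
  have ext: "(\<Sum>k\<le>degree f. smult (c' k) (Theta q k)) = (\<Sum>k\<le>d. smult (c' k) (Theta q k))"
    if "\<forall>k>degree f. c' k = 0" for c'
    using deg that by (intro sum.mono_neutral_left) auto
  have uniq: "c' = c" if "\<forall>k>degree f. c' k = 0" "f = (\<Sum>k\<le>degree f. smult (c' k) (Theta q k))" for c'
  proof
    fix k
    have "(\<Sum>k\<le>d. smult (c' k - c k) (Theta q k)) = 0"
      using trans[OF sym[OF assms(2)] trans[OF that(2) ext[OF that(1)]]]
      by (simp add: smult_diff_left sum_subtractf)
    then show "c' k = c k"
      using Theta_combination_eq_0[of "\<lambda>k. c' k - c k"] that(1) assms(1) deg
      by (cases "k \<le> d") auto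
  qed
  have "c k = 0" if "k > degree f" for k
  proof (rule ccontr)
    assume "c k \<noteq> 0"
    \<comment> \<open>At the last index with nonzero coordinate no other summand contributes to the
      coefficient of \<open>f\<close>: higher ones have coordinate 0, lower ones have too small a
      degree.\<close>
    define l where "l = Max {l. l \<le> d \<and> c l \<noteq> 0}"
    have k: "k \<in> {l. l \<le> d \<and> c l \<noteq> 0}"
      using \<open>c k \<noteq> 0\<close> assms(1)[of k] by (cases "k \<le> d") auto
    then have l: "l \<in> {l. l \<le> d \<and> c l \<noteq> 0}" "k \<le> l"
      unfolding l_def using Max_in[OF _ ex_in_conv[THEN iffD1, OF exI], OF _ k] Max_ge[OF _ k] by auto
    have "c j = 0" if "j > l" for j
    proof (rule ccontr)
      assume "c j \<noteq> 0"
      then have "j \<in> {l. l \<le> d \<and> c l \<noteq> 0}" using assms(1)[of j] by (cases "j \<le> d") auto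
      then have "j \<le> l" unfolding l_def by (intro Max_ge) auto
      with that show False by simp
    qed
    then have "poly.coeff f l = (\<Sum>j\<le>d. if j = l then c l else 0)"
      unfolding assms(2) coeff_sum
      by (intro sum.cong) (auto simp: coeff_Theta_self coeff_Theta_above neq_iff)
    then have "poly.coeff f l = c l" using l by simp
    moreover have "poly.coeff f l = 0" using l that by (simp add: coeff_eq_0)
    ultimately show False using l by simp
  qed
  then have "\<forall>k>degree f. c k = 0" by blast
  with uniq ext[OF this] assms(2) show ?thesis
    unfolding theta_coords_def by (intro the_equality) auto
qed

lemma theta_coords_Theta: "theta_coords q (Theta q n) = (\<lambda>k. if k = n then 1 else 0)"
  by (rule theta_coords_eqI[where d = n]) (auto simp: if_distrib[of "\<lambda>c. smult c _"] cong: if_cong)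

text \<open>For a period P modulo p^e the factors X - q_i and X - q_(P+i) agree, so Theta_P Theta_n
  is congruent to Theta_(P+n), and coordinates inherit the congruence.\<close>

lemma theta_coords_shift:
  assumes "prime p" "coprime q (int p)" "\<And>i. qseq q (P + i) - qseq q i \<in> Zideal p e"
  shows "theta_coords q (Theta q P * Theta q n) k - (if k = P + n then 1 else 0) \<in> Zideal p e"
proof -
  have "poly_in (Zideal p e) (Theta q P * Theta q n - Theta q (P + n))"
  proof (induction n)
    case 0
    then show ?case using assms(1) by (simp add: Theta_0 poly_in_def Zideal_0)
  next
    case (Suc n)
    let ?L = "[:- qseq q (Suc n), 1:]"
    let ?D = "[:qseq q (P + Suc n) - qseq q (Suc n):]"
    \<comment> \<open>The two new linear factors differ by the constant \<open>?D\<close>, which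
      lies in the ideal by periodicity.\<close>
    have eq: "Theta q P * Theta q (Suc n) - Theta q (P + Suc n) =
        ?L * (Theta q P * Theta q n - Theta q (P + n)) + Theta q (P + n) * ?D"
    proof -
      have *: "[:- qseq q (Suc (P + n)), 1:] = ?L - ?D" by simp
      show ?thesis unfolding add_Suc_right Theta_Suc * by (simp only: add_Suc_right algebra_simps)
    qed
    have L: "poly_in (Zloc p) ?L"
      using assms(1,2) by (auto simp: poly_in_def coeff_pCons Zloc_0 Zloc_1 Zloc_uminus qseq_in_Zloc
          split: nat.split)
    have D: "poly_in (Zideal p e) ?D"
      using assms by (auto simp: poly_in_def coeff_pCons Zideal_0 simp del: add_Suc_right split: nat.split)
    show ?case
      using poly_in_mult[OF assms(1) L Suc]
        poly_in_mult[OF assms(1) poly_in_Theta[OF assms(1,2)] D, of "P + n"]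
      unfolding eq poly_in_def coeff_add by (blast intro: Zideal_add[OF assms(1)])
  qed
  moreover have "degree (Theta q P * Theta q n - Theta q (P + n)) \<le> P + n"
    by (intro degree_diff_le order_trans[OF degree_mult_le]) (auto simp: degree_Theta)
  ultimately obtain c where c: "\<And>k. c k \<in> Zideal p e" "\<And>k. k > P + n \<Longrightarrow> c k = 0"
      "Theta q P * Theta q n - Theta q (P + n) = (\<Sum>k\<le>P + n. smult (c k) (Theta q k))"
    using Theta_expansion[OF assms(1,2)] by blast
  let ?c = "\<lambda>k. c k + (if k = P + n then 1 else 0)"
  have "Theta q P * Theta q n = (\<Sum>k\<le>P + n. smult (c k) (Theta q k)) + Theta q (P + n)"
    using c(3) by (simp add: algebra_simps)
  also have "Theta q (P + n) = (\<Sum>k\<le>P + n. smult (if k = P + n then 1 else 0) (Theta q k))"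
    by (simp add: if_distrib[of "\<lambda>c. smult c _"] cong: if_cong)
  finally have "Theta q P * Theta q n = (\<Sum>k\<le>P + n. smult (?c k) (Theta q k))"
    by (simp add: smult_add_left sum.distrib)
  then have "theta_coords q (Theta q P * Theta q n) = ?c"
    by (intro theta_coords_eqI[where d = "P + n"]) (use c(2) in auto)
  then show ?thesis using c(1) by simp
qed

section \<open>Multiplication in A\<close>

lemma A_ring_simps:
  "a \<in> carrier (A_ring p q) \<longleftrightarrow> (\<forall>n. a n \<in> Zloc p)"
  "a \<otimes>\<^bsub>A_ring p q\<^esub> b = A_mult q a b"
  "\<one>\<^bsub>A_ring p q\<^esub> = A_const 1"
  "\<zero>\<^bsub>A_ring p q\<^esub> = (\<lambda>n. 0)"
  "a \<oplus>\<^bsub>A_ring p q\<^esub> b = (\<lambda>n. a n + b n)"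
  by (auto simp: A_ring_def A_const_def)

definition Phi :: "nat \<Rightarrow> nat \<Rightarrow> rat" where
  "Phi n k = (if k = n then 1 else 0)"

text \<open>The effect on coefficients, modulo p^e, of multiplication by \<open>Phi n\<close> when n
  is a period of q_i.\<close>

definition shift :: "nat \<Rightarrow> (nat \<Rightarrow> rat) \<Rightarrow> nat \<Rightarrow> rat" where
  "shift n a k = (if k < n then 0 else a (k - n))"

lemma A_mult_Phi:
  "A_mult q (Phi m) b k =
    (if m \<le> k then \<Sum>n\<le>k. b n * theta_coords q (Theta q m * Theta q n) k else 0)"
proof -
  have "A_mult q (Phi m) b k = (\<Sum>i\<le>k. if i = m then \<Sum>n\<le>k. b n * theta_coords q (Theta q m * Theta q n) k else 0)"
    unfolding A_mult_def by (intro sum.cong) (auto simp: Phi_def)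
  then show ?thesis by simp
qed

lemma A_mult_const: "A_mult q (A_const r) b = (\<lambda>k. r * b k)"
proof
  fix k
  have "A_mult q (A_const r) b k =
      (\<Sum>m\<le>k. if m = 0 then \<Sum>n\<le>k. r * b n * theta_coords q (Theta q n) k else 0)"
    unfolding A_mult_def by (intro sum.cong) (auto simp: A_const_def Theta_0)
  also have "\<dots> = r * b k"
    by (simp add: theta_coords_Theta if_distrib[of "\<lambda>c. _ * c"] cong: if_cong)
  finally show "A_mult q (A_const r) b k = r * b k" .
qed

text \<open>In the sum for the k-th coefficient only n = k - P survives modulo p^e; all other terms
  have their coordinate in the ideal.\<close>

lemma A_mult_Phi_shift:
  assumes "prime p" "coprime q (int p)" "\<And>i. qseq q (P + i) - qseq q i \<in> Zideal p e"
    and b: "\<And>n. b n \<in> Zloc p"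
  shows "A_mult q (Phi P) b k - shift P b k \<in> Zideal p e"
proof (cases "P \<le> k")
  case True
  have "shift P b k = (\<Sum>n\<le>k. if n = k - P then b n else 0)"
    using True by (simp add: shift_def)
  also have "\<dots> = (\<Sum>n\<le>k. b n * (if k = P + n then 1 else 0))"
    using True by (intro sum.cong) auto
  finally have "A_mult q (Phi P) b k - shift P b k =
      (\<Sum>n\<le>k. b n * (theta_coords q (Theta q P * Theta q n) k - (if k = P + n then 1 else 0)))"
    using True by (simp add: A_mult_Phi right_diff_distrib sum_subtractf)
  then show ?thesis
    using theta_coords_shift[OF assms(1-3)] b
    by (auto intro!: Zideal_sum Zideal_mult simp: assms(1))
next
  case False
  then show ?thesis by (simp add: A_mult_Phi shift_def Zideal_0 assms(1))
qed

section \<open>M as a module over Z_(p)\<close>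

locale A_module = Module.module "A_ring p q" M
  for p :: nat and q :: int and M :: "(nat \<Rightarrow> rat, 'b) module" (structure) +
  assumes p: "prime p" and q: "coprime q (int p)"
begin

abbreviation A where "A \<equiv> A_ring p q"

abbreviation scale :: "rat \<Rightarrow> 'b \<Rightarrow> 'b" where "scale r y \<equiv> A_const r \<odot> y"

lemma A_const_closed: "r \<in> Zloc p \<Longrightarrow> A_const r \<in> carrier A"
  using p by (auto simp: A_ring_simps A_const_def Zloc_0)

lemma Phi_closed: "Phi n \<in> carrier A"
  using p by (auto simp: A_ring_simps Phi_def Zloc_0 Zloc_1)

lemma A_minus: "a \<in> carrier A \<Longrightarrow> b \<in> carrier A \<Longrightarrow> a \<ominus>\<^bsub>A\<^esub> b = (\<lambda>n. a n - b n)"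
proof -
  assume ab: "a \<in> carrier A" "b \<in> carrier A"
  have "\<ominus>\<^bsub>A\<^esub> b = (\<lambda>n. - b n)"
    using ab p by (intro R.minus_equality) (auto simp: A_ring_simps Zloc_uminus)
  then show ?thesis by (simp add: a_minus_def A_ring_simps)
qed

lemma scale_closed: "r \<in> Zloc p \<Longrightarrow> y \<in> carrier M \<Longrightarrow> scale r y \<in> carrier M"
  by (simp add: A_const_closed)

lemma scale_add_left:
  "r \<in> Zloc p \<Longrightarrow> s \<in> Zloc p \<Longrightarrow> y \<in> carrier M \<Longrightarrow> scale (r + s) y = scale r y \<oplus> scale s y"
proof -
  assume *: "r \<in> Zloc p" "s \<in> Zloc p" "y \<in> carrier M"
  have "A_const (r + s) = A_const r \<oplus>\<^bsub>A\<^esub> A_const s"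
    by (auto simp: A_ring_simps A_const_def)
  with * show ?thesis by (simp add: smult_l_distr A_const_closed)
qed

lemma scale_add_right:
  "r \<in> Zloc p \<Longrightarrow> y \<in> carrier M \<Longrightarrow> z \<in> carrier M \<Longrightarrow> scale r (y \<oplus> z) = scale r y \<oplus> scale r z"
  by (simp add: smult_r_distr A_const_closed)

lemma scale_scale:
  "r \<in> Zloc p \<Longrightarrow> s \<in> Zloc p \<Longrightarrow> y \<in> carrier M \<Longrightarrow> scale r (scale s y) = scale (r * s) y"
proof -
  assume *: "r \<in> Zloc p" "s \<in> Zloc p" "y \<in> carrier M"
  have "A_const (r * s) = A_const r \<otimes>\<^bsub>A\<^esub> A_const s"
    by (auto simp: A_ring_simps A_mult_const) (auto simp: A_const_def)
  with * show ?thesis by (simp add: smult_assoc1 A_const_closed)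
qed

lemma scale_0: "y \<in> carrier M \<Longrightarrow> scale 0 y = \<zero>"
proof -
  assume "y \<in> carrier M"
  moreover have "A_const 0 = \<zero>\<^bsub>A\<^esub>" by (auto simp: A_ring_simps A_const_def)
  ultimately show ?thesis by simp
qed

lemma scale_1: "y \<in> carrier M \<Longrightarrow> scale 1 y = y"
  using smult_one[of y] by (simp add: A_ring_simps)

lemma scale_uminus: "y \<in> carrier M \<Longrightarrow> scale (- 1) y = \<ominus> y"
proof -
  assume y: "y \<in> carrier M"
  have "scale (- 1) y \<oplus> y = scale (- 1 + 1) y"
    using y p Zloc_of_int[of p "-1"] by (subst scale_add_left) (auto simp: scale_1 Zloc_1)
  then show ?thesis
    using y p Zloc_of_int[of p "-1"] by (simp add: scale_0 M.minus_equality scale_closed)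
qed

lemma smult_scale:
  "a \<in> carrier A \<Longrightarrow> r \<in> Zloc p \<Longrightarrow> y \<in> carrier M \<Longrightarrow> a \<odot> scale r y = scale r (a \<odot> y)"
  by (simp add: R.m_comm A_const_closed flip: smult_assoc1)

section \<open>Z_(p)-submodules and Krull's theorem\<close>

text \<open>Closure under negation is contained in scaling by -1.\<close>

definition Zsub :: "'b set \<Rightarrow> bool" where
  "Zsub U \<longleftrightarrow> U \<subseteq> carrier M \<and> \<zero> \<in> U \<and> (\<forall>y\<in>U. \<forall>z\<in>U. y \<oplus> z \<in> U) \<and>
     (\<forall>r\<in>Zloc p. \<forall>y\<in>U. scale r y \<in> U)"

lemma Zsub_carrier: "Zsub U \<Longrightarrow> y \<in> U \<Longrightarrow> y \<in> carrier M"
  and Zsub_zero: "Zsub U \<Longrightarrow> \<zero> \<in> U"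
  and Zsub_add: "Zsub U \<Longrightarrow> y \<in> U \<Longrightarrow> z \<in> U \<Longrightarrow> y \<oplus> z \<in> U"
  and Zsub_scale: "Zsub U \<Longrightarrow> r \<in> Zloc p \<Longrightarrow> y \<in> U \<Longrightarrow> scale r y \<in> U"
  unfolding Zsub_def by auto

definition adjoin :: "'b \<Rightarrow> 'b set \<Rightarrow> 'b set" where
  "adjoin s U = {scale c s \<oplus> u | c u. c \<in> Zloc p \<and> u \<in> U}"

lemma adjoinE:
  assumes "w \<in> adjoin s U"
  obtains c u where "c \<in> Zloc p" "u \<in> U" "w = scale c s \<oplus> u"
  using assms unfolding adjoin_def by blast

lemma adjoin_superset: "s \<in> carrier M \<Longrightarrow> Zsub U \<Longrightarrow> U \<subseteq> adjoin s U"
proof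
  fix u assume *: "s \<in> carrier M" "Zsub U" "u \<in> U"
  then have "u = scale 0 s \<oplus> u" by (simp add: scale_0 Zsub_carrier)
  with * show "u \<in> adjoin s U" unfolding adjoin_def using Zloc_0[OF p] by blast
qed

lemma adjoin_mem: "s \<in> carrier M \<Longrightarrow> Zsub U \<Longrightarrow> s \<in> adjoin s U"
proof -
  assume *: "s \<in> carrier M" "Zsub U"
  then have "s = scale 1 s \<oplus> \<zero>" by (simp add: scale_1)
  with * show "s \<in> adjoin s U" unfolding adjoin_def using Zloc_1[OF p] Zsub_zero by blast
qed

lemma Zsub_adjoin:
  assumes "s \<in> carrier M" "Zsub U"
  shows "Zsub (adjoin s U)"
  unfolding Zsub_def
proof (intro conjI ballI)
  show "adjoin s U \<subseteq> carrier M"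
    using assms by (auto simp: adjoin_def scale_closed Zsub_carrier)
  show "\<zero> \<in> adjoin s U" using adjoin_superset assms Zsub_zero by blast
next
  fix y z assume "y \<in> adjoin s U" "z \<in> adjoin s U"
  then obtain c u d v where *: "c \<in> Zloc p" "u \<in> U" "y = scale c s \<oplus> u"
      "d \<in> Zloc p" "v \<in> U" "z = scale d s \<oplus> v"
    by (auto elim!: adjoinE)
  then have "y \<oplus> z = scale (c + d) s \<oplus> (u \<oplus> v)"
    using assms by (simp add: scale_add_left scale_closed Zsub_carrier M.a_ac)
  then show "y \<oplus> z \<in> adjoin s U"
    unfolding adjoin_def using * Zloc_add[OF p] Zsub_add[OF assms(2)] by blast
next
  fix r y assume "r \<in> Zloc p" "y \<in> adjoin s U"
  then obtain c u where *: "r \<in> Zloc p" "c \<in> Zloc p" "u \<in> U" "y = scale c s \<oplus> u"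
    by (auto elim!: adjoinE)
  then have "scale r y = scale (r * c) s \<oplus> scale r u"
    using assms by (simp add: scale_add_right scale_scale scale_closed Zsub_carrier)
  then show "scale r y \<in> adjoin s U"
    unfolding adjoin_def using * Zloc_mult[OF p] Zsub_scale[OF assms(2)] by blast
qed

text \<open>This reduces uniqueness of the coefficient of \<open>s\<close> modulo \<open>U\<close>
  to the question which multiples of \<open>s\<close> lie in \<open>U\<close>.\<close>

lemma scale_diff_mem:
  assumes "Zsub U" "s \<in> carrier M" "a \<in> Zloc p" "b \<in> Zloc p" "u \<in> U" "v \<in> U"
    and eq: "scale a s \<oplus> u = scale b s \<oplus> v"
  shows "scale (a - b) s \<in> U"
proof -
  have uv: "u \<in> carrier M" "v \<in> carrier M" using assms Zsub_carrier by auto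
  have ab: "a - b \<in> Zloc p" using assms p by (simp add: Zloc_diff)
  have X: "scale (a - b) s \<in> carrier M" "scale b s \<in> carrier M"
    using assms ab by (auto intro!: scale_closed)
  have "scale a s = scale b s \<oplus> scale (a - b) s"
    using scale_add_left[OF assms(4) ab assms(2)] by simp
  with eq uv X have "scale (a - b) s \<oplus> u = v" by (simp add: M.a_assoc)
  then have "scale (a - b) s = v \<oplus> \<ominus> u"
    using uv X by (auto simp: M.a_assoc M.r_neg)
  then show ?thesis
    using assms(1,5,6) uv Zloc_of_int[OF p, of "-1"]
    by (simp add: Zsub_add Zsub_scale flip: scale_uminus)
qed

text \<open>Krull's intersection theorem for modules over the discrete valuation ring \<open>Zloc p\<close>,
  by induction on the generators of \<open>N\<close> modulo \<open>U\<close>; bounding the torsion of \<open>N / U\<close> is what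
  allows p-divisibility to be transferred from one step of the filtration to the next.\<close>

lemma bounded_torsion_and_separated:
  assumes "finite S" "Zsub N" "S \<subseteq> N" "Zsub U" "U \<subseteq> N"
    and "\<And>V. Zsub V \<Longrightarrow> U \<subseteq> V \<Longrightarrow> S \<subseteq> V \<Longrightarrow> N \<subseteq> V"
  shows "(\<exists>t. \<forall>z\<in>N. \<forall>i. scale (of_nat p ^ i) z \<in> U \<longrightarrow> scale (of_nat p ^ t) z \<in> U) \<and>
    (\<forall>y. (\<forall>e. \<exists>z\<in>N. y = scale (of_nat p ^ e) z) \<longrightarrow> y \<in> U)"
  using assms(1,3-6)
proof (induction S arbitrary: U rule: finite_induct)
  case empty
  then have "N = U" by blast
  with \<open>Zsub N\<close> show ?case
    by (auto intro!: Zsub_scale Zloc_of_nat_power[OF p] exI[of _ 0])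
       (metis Zsub_scale Zloc_of_nat_power[OF p])
next
  case (insert s S)
  let ?p = "\<lambda>i. of_nat p ^ i :: rat"
  note pz = Zloc_of_nat_power[OF p]
  have sN: "s \<in> N" and s: "s \<in> carrier M"
    using insert.prems Zsub_carrier[OF \<open>Zsub N\<close>] by auto
  note U = \<open>Zsub U\<close>
  \<comment> \<open>Modulo \<open>U'\<close> the generators in \<open>S\<close> suffice, so the
    induction hypothesis applies there. What remains is the descent through the cyclic quotient of
    \<open>U'\<close> by \<open>U\<close>.\<close>
  define U' where "U' = adjoin s U"
  have U': "Zsub U'" "U \<subseteq> U'" "s \<in> U'"
    using U s by (auto simp: U'_def Zsub_adjoin adjoin_mem adjoin_superset[THEN subsetD])
  have "U' \<subseteq> N"
    using insert.prems(3) sN \<open>Zsub N\<close>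
    by (auto simp: U'_def adjoin_def intro!: Zsub_add Zsub_scale)
  moreover have "N \<subseteq> V" if "Zsub V" "U' \<subseteq> V" "S \<subseteq> V" for V
    using insert.prems(4)[OF that(1)] that U' by blast
  moreover have "S \<subseteq> N" using insert.prems(1) by blast
  ultimately have IH: "\<exists>t. \<forall>z\<in>N. \<forall>i. scale (?p i) z \<in> U' \<longrightarrow> scale (?p t) z \<in> U'"
      "\<forall>y. (\<forall>e. \<exists>z\<in>N. y = scale (?p e) z) \<longrightarrow> y \<in> U'"
    using insert.IH[of U'] U' by blast+
  obtain t where t: "\<And>z i. z \<in> N \<Longrightarrow> scale (?p i) z \<in> U' \<Longrightarrow> scale (?p t) z \<in> U'"
    using IH(1) by blast
  have NM: "z \<in> carrier M" if "z \<in> N" for z using Zsub_carrier[OF \<open>Zsub N\<close> that] .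
  have pp: "scale (?p (i + j)) z = scale (?p i) (scale (?p j) z)" if "z \<in> N" for i j z
    using NM[OF that] pz by (simp add: scale_scale power_add)
  have scale_expand: "scale r (scale c s \<oplus> u) = scale (r * c) s \<oplus> scale r u"
    if "r \<in> Zloc p" "c \<in> Zloc p" "u \<in> U" for r c u
    using that s U by (simp add: scale_add_right scale_scale scale_closed Zsub_carrier)
  \<comment> \<open>Either \<open>s\<close> is torsion modulo \<open>U\<close>, and a power of p
    carries \<open>U'\<close> into \<open>U\<close>, or the quotient is free on \<open>s\<close> and
    coefficients can be compared.\<close>
  show ?case
  proof (cases "\<exists>k. scale (?p k) s \<in> U")
    case True
    then obtain k where k: "scale (?p k) s \<in> U" by blast
    have kU: "scale (?p k) w \<in> U" if w: "w \<in> U'" for w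
    proof -
      obtain c u where c: "c \<in> Zloc p" "u \<in> U" "w = scale c s \<oplus> u"
        using w unfolding U'_def by (rule adjoinE)
      then have "scale (?p k) w = scale c (scale (?p k) s) \<oplus> scale (?p k) u"
        using s pz by (simp add: scale_expand scale_scale mult.commute)
      with c k U pz show ?thesis by (simp add: Zsub_add Zsub_scale)
    qed
    \<comment> \<open>The premise asks for \<open>U'\<close> only, which gives separation too: an
      infinitely divisible y lies in \<open>U'\<close> by induction and equals p^(k+t) z for some z,
      hence lies in \<open>U\<close>.\<close>
    have "scale (?p (k + t)) z \<in> U" if "z \<in> N" "scale (?p i) z \<in> U'" for z i
      using kU[OF t[OF that]] that by (simp add: pp)
    then show ?thesis using IH(2) U'(2) by (metis subsetD)
  next
    case False
    have zero: "c = 0" if cU: "c \<in> Zloc p" "scale c s \<in> U" for c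
    proof (rule ccontr)
      assume "c \<noteq> 0"
      then obtain k d where kd: "d \<in> Zloc p" "?p k = d * c"
        using Zloc_dvd_power[OF p cU(1)] by blast
      then have "scale (?p k) s = scale d (scale c s)" using cU s by (simp add: scale_scale)
      also have "\<dots> \<in> U" using U kd(1) cU(2) by (rule Zsub_scale)
      finally show False using False by blast
    qed
    have eqD: "a = b" if "a \<in> Zloc p" "b \<in> Zloc p" "u \<in> U" "v \<in> U"
        "scale a s \<oplus> u = scale b s \<oplus> v" for a b u v
      using zero[of "a - b"] scale_diff_mem[OF U s that] Zloc_diff[OF p that(1,2)] by simp
    have "scale (?p t) z \<in> U" if z: "z \<in> N" "scale (?p i) z \<in> U" for z i
    proof -
      have "scale (?p t) z \<in> U'" using t z U' by blast
      then obtain c u where c: "c \<in> Zloc p" "u \<in> U" "scale (?p t) z = scale c s \<oplus> u"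
        unfolding U'_def by (rule adjoinE)
      have "scale (?p i * c) s \<oplus> scale (?p i) u = scale (?p i) (scale (?p t) z)"
        using c pz by (simp add: scale_expand)
      also have "\<dots> = scale (?p t) (scale (?p i) z)"
        using pp[OF z(1), of i t] pp[OF z(1), of t i] by (simp add: add.commute)
      \<comment> \<open>Writing the right side with coefficient 0 at \<open>s\<close> lets
        \<open>eqD\<close> give p^i c = 0. Thus the torsion bound t for \<open>U'\<close> also
        serves for \<open>U\<close>.\<close>
      also have "\<dots> = scale 0 s \<oplus> scale (?p t) (scale (?p i) z)"
        using z s pz NM U by (simp add: scale_0 scale_closed)
      finally have "?p i * c = 0"
        using c z pz U by (intro eqD) (auto intro: Zloc_mult[OF p] Zsub_scale Zloc_0[OF p])
      then have "c = 0" using p by (auto simp: prime_nat_iff)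
      then show ?thesis using c s U by (simp add: scale_0 Zsub_carrier)
    qed
    moreover have "y \<in> U" if y: "\<forall>e. \<exists>z\<in>N. y = scale (?p e) z" for y
    proof -
      have yU': "y \<in> U'" using IH(2) y by blast
      then obtain c u where c: "c \<in> Zloc p" "u \<in> U" "y = scale c s \<oplus> u"
        unfolding U'_def by (rule adjoinE)
      have "c = 0"
      proof (rule ccontr)
        assume "c \<noteq> 0"
        then obtain k d where kd: "d \<in> Zloc p" "?p k = d * c"
          using Zloc_dvd_power[OF p c(1)] by blast
        \<comment> \<open>The part t of the exponent brings the multiple of z into \<open>U'\<close>
          by bounded torsion; the part k + 1 makes p^(k+1) divide c, although c divides p^k.\<close>
        obtain z where z: "z \<in> N" "y = scale (?p (Suc k + t)) z" using y by blast
        then have "scale (?p t) z \<in> U'" using t yU' by blast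
        then obtain c' u' where c': "c' \<in> Zloc p" "u' \<in> U" "scale (?p t) z = scale c' s \<oplus> u'"
          unfolding U'_def by (rule adjoinE)
        have "scale c s \<oplus> u = scale (?p (Suc k) * c') s \<oplus> scale (?p (Suc k)) u'"
          using c(3) z(2) c' pz[of "Suc k"] unfolding pp[OF z(1)] by (metis scale_expand)
        then have eq: "c = ?p (Suc k) * c'"
          using c c' pz[of "Suc k"] U by (intro eqD) (auto intro: Zloc_mult[OF p] Zsub_scale)
        have "?p k * (of_nat p * (d * c')) = d * (?p (Suc k) * c')" by (simp add: mult_ac)
        also have "\<dots> = d * c" by (simp only: eq[symmetric])
        also have "\<dots> = ?p k * 1" using kd(2) by simp
        finally have "?p k * 1 = ?p k * (of_nat p * (d * c'))" by (rule sym)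
        moreover have "?p k \<noteq> 0" using p by (auto simp: prime_nat_iff)
        ultimately have "1 = of_nat p * (d * c')" by (metis mult_left_cancel)
        then show False using Zloc_p_not_unit[OF p Zloc_mult[OF p kd(1) c'(1)]] by simp
      qed
      then show ?thesis using c s U by (simp add: scale_0 Zsub_carrier)
    qed
    ultimately show ?thesis by blast
  qed
qed

section \<open>Finite spans over Z_(p)\<close>

definition Zspan :: "'b set \<Rightarrow> 'b set" where
  "Zspan S = {finsum M (\<lambda>s. scale (c s) s) S | c. c \<in> S \<rightarrow> Zloc p}"

lemma Zspan_least:
  assumes "finite S" "Zsub U" "S \<subseteq> U"
  shows "Zspan S \<subseteq> U"
proof -
  have "finsum M (\<lambda>s. scale (c s) s) S \<in> U" if "c \<in> S \<rightarrow> Zloc p" for c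
    using assms(1,3) that
  proof (induction S rule: finite_induct)
    case empty
    then show ?case using assms(2) by (simp add: Zsub_zero)
  next
    case (insert s S)
    then have "(\<lambda>s. scale (c s) s) \<in> S \<rightarrow> carrier M" "scale (c s) s \<in> carrier M"
      using Zsub_carrier[OF assms(2)] by (auto intro!: scale_closed simp: Pi_def)
    then show ?case
      using insert assms(2) by (auto simp: Pi_def intro!: Zsub_add Zsub_scale)
  qed
  then show ?thesis by (auto simp: Zspan_def)
qed

lemma Zspan_superset:
  assumes "finite S" "S \<subseteq> carrier M"
  shows "S \<subseteq> Zspan S"
proof
  fix s assume s: "s \<in> S"
  have "finsum M (\<lambda>t. scale (if s = t then 1 else 0) t) S = finsum M (\<lambda>t. if s = t then t else \<zero>) S"
    using assms by (intro M.finsum_cong') (auto simp: scale_0 scale_1)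
  also have "\<dots> = s" using s assms by (intro M.finsum_singleton) auto
  finally show "s \<in> Zspan S"
    unfolding Zspan_def using p
    by (intro CollectI exI[of _ "\<lambda>t. if s = t then 1 else 0"]) (auto simp: Zloc_0 Zloc_1)
qed

lemma Zsub_Zspan:
  assumes "finite S" "S \<subseteq> carrier M"
  shows "Zsub (Zspan S)"
  unfolding Zsub_def
proof (intro conjI ballI)
  have maps: "(\<lambda>s. scale (c s) s) \<in> S \<rightarrow> carrier M" if "c \<in> S \<rightarrow> Zloc p" for c
    using that assms by (auto intro!: scale_closed)
  show "Zspan S \<subseteq> carrier M" unfolding Zspan_def using maps by auto
  have "finsum M (\<lambda>s. scale 0 s) S = finsum M (\<lambda>s. \<zero>) S"
    using assms by (intro M.finsum_cong') (auto simp: scale_0)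
  then have "\<zero> = finsum M (\<lambda>s. scale 0 s) S" by simp
  then show "\<zero> \<in> Zspan S"
    unfolding Zspan_def using Zloc_0[OF p] by (intro CollectI exI[of _ "\<lambda>_. 0"]) auto
  fix y assume "y \<in> Zspan S"
  then obtain c where c: "c \<in> S \<rightarrow> Zloc p" "y = finsum M (\<lambda>s. scale (c s) s) S"
    by (auto simp: Zspan_def)
  {
    fix z assume "z \<in> Zspan S"
    then obtain d where d: "d \<in> S \<rightarrow> Zloc p" "z = finsum M (\<lambda>s. scale (d s) s) S"
      by (auto simp: Zspan_def)
    have "y \<oplus> z = finsum M (\<lambda>s. scale (c s) s \<oplus> scale (d s) s) S"
      using c d maps by simp
    also have "\<dots> = finsum M (\<lambda>s. scale (c s + d s) s) S"
      using c d assms by (intro M.finsum_cong') (auto simp: scale_add_left Pi_def subset_iff intro!: scale_closed Zloc_add[OF p])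
    finally show "y \<oplus> z \<in> Zspan S"
      unfolding Zspan_def using c(1) d(1) Zloc_add[OF p]
      by (intro CollectI exI[of _ "\<lambda>s. c s + d s"]) (auto simp: Pi_def)
  next
    fix r assume r: "r \<in> Zloc p"
    have "scale r y = finsum M (\<lambda>s. scale r (scale (c s) s)) S"
      unfolding c(2) using maps[OF c(1)] r assms(1) by (intro finsum_smult_ldistr A_const_closed)
    also have "\<dots> = finsum M (\<lambda>s. scale (r * c s) s) S"
      using c r assms by (intro M.finsum_cong') (auto simp: scale_scale Pi_def subset_iff intro!: scale_closed Zloc_mult[OF p])
    finally show "scale r y \<in> Zspan S"
      unfolding Zspan_def using c(1) r Zloc_mult[OF p]
      by (intro CollectI exI[of _ "\<lambda>s. r * c s"]) (auto simp: Pi_def)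
  }
qed

text \<open>Krull's theorem over the submodule \<open>{\<zero>}\<close>; minimality of the span
  supplies its generation hypothesis.\<close>

lemma Zspan_separated:
  assumes "finite S" "S \<subseteq> carrier M"
    and "\<And>e. \<exists>z\<in>Zspan S. y = scale (of_nat p ^ e) z"
  shows "y = \<zero>"
proof -
  have N: "Zsub (Zspan S)" using assms by (intro Zsub_Zspan)
  have "Zsub {\<zero>}" using A_const_closed by (auto simp: Zsub_def)
  moreover have "Zspan S \<subseteq> V" if "Zsub V" "S \<subseteq> V" for V
    using assms that by (intro Zspan_least)
  ultimately have "y \<in> {\<zero>}"
    using bounded_torsion_and_separated[OF assms(1) N Zspan_superset[OF assms(1,2)], of "{\<zero>}"]
      Zsub_zero[OF N] assms(3) by blast
  then show ?thesis by simp
qed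

text \<open>Adjoining one generator keeps a submodule countable, as Z_(p) consists of
  rationals.\<close>

lemma countable_Zspan:
  assumes "finite S" "S \<subseteq> carrier M"
  shows "countable (Zspan S)"
proof -
  have "\<exists>V. Zsub V \<and> countable V \<and> S \<subseteq> V"
    using assms
  proof (induction S rule: finite_induct)
    case empty
    have "Zsub {\<zero>}" using A_const_closed by (auto simp: Zsub_def)
    then show ?case by (intro exI[of _ "{\<zero>}"]) auto
  next
    case (insert s S)
    then obtain V where V: "Zsub V" "countable V" "S \<subseteq> V" and s: "s \<in> carrier M" by auto
    have "adjoin s V = (\<lambda>(c, u). scale c s \<oplus> u) ` (Zloc p \<times> V)"
      by (auto simp: adjoin_def)
    then have "countable (adjoin s V)" using V(2) by simp
    then show ?case
      using V(3) Zsub_adjoin[OF s V(1)] adjoin_mem[OF s V(1)] adjoin_superset[OF s V(1)] by blast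
  qed
  then obtain V where "Zsub V" "countable V" "S \<subseteq> V" by blast
  then show ?thesis using countable_subset[OF Zspan_least[OF assms(1)]] by blast
qed

text \<open>\<open>F\<close> consists of the combinations with coefficients 0, ..., p^e - 1;
  reducing each coefficient to its residue leaves a multiple of p^e.\<close>

lemma Zspan_finite_index:
  assumes "finite S" "S \<subseteq> carrier M"
  obtains F where "finite F" "F \<subseteq> Zspan S"
    "\<And>y. y \<in> Zspan S \<Longrightarrow> \<exists>f\<in>F. \<exists>z\<in>Zspan S. y = f \<oplus> scale (of_nat p ^ e) z"
proof
  let ?f = "\<lambda>r. finsum M (\<lambda>s. scale (r s) s) S"
  let ?R = "S \<rightarrow>\<^sub>E (of_int ` {0..<int p ^ e} :: rat set)"
  show "finite (?f ` ?R)"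
    using assms(1) by (intro finite_imageI finite_PiE) auto
  have "r \<in> S \<rightarrow> Zloc p" if "r \<in> ?R" for r
    using that Zloc_of_int[OF p] by (fastforce simp: PiE_def Pi_def)
  then show "?f ` ?R \<subseteq> Zspan S" by (auto simp: Zspan_def)
  fix y assume "y \<in> Zspan S"
  then obtain c where c: "c \<in> S \<rightarrow> Zloc p" "y = ?f c" by (auto simp: Zspan_def)
  have "\<exists>r d. 0 \<le> r \<and> r < int p ^ e \<and> d \<in> Zloc p \<and> c s = of_int r + of_nat p ^ e * d"
    if "s \<in> S" for s
    using Zloc_residue[OF p, of "c s" e] c(1) that by (metis Pi_mem)
  then obtain r d where rd: "\<And>s. s \<in> S \<Longrightarrow> 0 \<le> r s" "\<And>s. s \<in> S \<Longrightarrow> r s < int p ^ e"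
      "\<And>s. s \<in> S \<Longrightarrow> d s \<in> Zloc p" "\<And>s. s \<in> S \<Longrightarrow> c s = of_int (r s) + of_nat p ^ e * d s"
    by metis
  note cl = Zloc_of_nat_power[OF p] Zloc_of_int[OF p] Zloc_mult[OF p]
  define r' where "r' = (\<lambda>s\<in>S. of_int (r s) :: rat)"
  have S: "s \<in> carrier M" if "s \<in> S" for s using that assms by auto
  have "y = finsum M (\<lambda>s. scale (r' s) s \<oplus> scale (of_nat p ^ e) (scale (d s) s)) S"
    unfolding c(2) using rd cl S
    by (intro M.finsum_cong') (auto simp: scale_scale scale_add_left r'_def intro!: scale_closed)
  also have "\<dots> = ?f r' \<oplus> finsum M (\<lambda>s. scale (of_nat p ^ e) (scale (d s) s)) S"
    using rd cl S by (intro M.finsum_addf) (auto simp: r'_def intro!: scale_closed)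
  also have "finsum M (\<lambda>s. scale (of_nat p ^ e) (scale (d s) s)) S = scale (of_nat p ^ e) (?f d)"
    using rd cl S assms(1)
    by (intro finsum_smult_ldistr[symmetric] A_const_closed) (auto intro!: scale_closed)
  finally have "y = ?f r' \<oplus> scale (of_nat p ^ e) (?f d)" .
  moreover have "r' \<in> ?R" using rd by (auto simp: r'_def)
  moreover have "?f d \<in> Zspan S" using rd by (auto simp: Zspan_def)
  ultimately show "\<exists>f\<in>?f ` ?R. \<exists>z\<in>Zspan S. y = f \<oplus> scale (of_nat p ^ e) z" by blast
qed

section \<open>Cyclic submodules, and discreteness implies finite generation\<close>

lemma smult_in_cyclic: "a \<in> carrier A \<Longrightarrow> a \<odot> x \<in> cyclic_sub p q M x"
  by (auto simp: cyclic_sub_def)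

lemma Zsub_cyclic:
  assumes "x \<in> carrier M"
  shows "Zsub (cyclic_sub p q M x)"
  unfolding Zsub_def
proof (intro conjI ballI)
  show "cyclic_sub p q M x \<subseteq> carrier M" using assms by (auto simp: cyclic_sub_def)
  show "\<zero> \<in> cyclic_sub p q M x"
    using smult_in_cyclic[OF R.zero_closed, of x] assms by simp
next
  fix y z assume "y \<in> cyclic_sub p q M x" "z \<in> cyclic_sub p q M x"
  then obtain a b where "a \<in> carrier A" "b \<in> carrier A" "y = a \<odot> x" "z = b \<odot> x"
    by (auto simp: cyclic_sub_def)
  then show "y \<oplus> z \<in> cyclic_sub p q M x"
    using smult_in_cyclic[of "a \<oplus>\<^bsub>A\<^esub> b" x] assms by (simp add: smult_l_distr)
next
  fix r y assume "r \<in> Zloc p" "y \<in> cyclic_sub p q M x"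
  then obtain a where "r \<in> Zloc p" "a \<in> carrier A" "y = a \<odot> x"
    by (auto simp: cyclic_sub_def)
  then show "scale r y \<in> cyclic_sub p q M x"
    using smult_in_cyclic[of "A_const r \<otimes>\<^bsub>A\<^esub> a" x] assms
    by (simp add: smult_assoc1 A_const_closed)
qed

lemma A_ideal_mem: "a \<in> A_ideal p q n \<longleftrightarrow> a \<in> carrier A \<and> (\<forall>k<n. a k = 0)"
  by (simp add: A_ideal_def)

text \<open>Descending induction from A_n, which acts as zero: an element of A_k is a_k Phi_k plus
  an element of A_(k+1).\<close>

lemma annihilated_imp_fg:
  assumes x: "x \<in> carrier M" and ann: "\<forall>a\<in>A_ideal p q n. a \<odot> x = \<zero>"
  shows "\<exists>S. finite S \<and> S \<subseteq> cyclic_sub p q M x \<and> cyclic_sub p q M x = Zspan S"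
proof (intro exI conjI)
  let ?S = "(\<lambda>k. Phi k \<odot> x) ` {..<n}"
  show "finite ?S" by simp
  show sub: "?S \<subseteq> cyclic_sub p q M x"
    using smult_in_cyclic[OF Phi_closed] by blast
  have SM: "?S \<subseteq> carrier M" using x Phi_closed by auto
  have span: "Zsub (Zspan ?S)" using SM by (intro Zsub_Zspan) auto
  have "a \<odot> x \<in> Zspan ?S" if "a \<in> A_ideal p q k" "k \<le> n" for a k
    using that(2,1)
  proof (induction k arbitrary: a rule: inc_induct)
    case base
    then show ?case using ann Zsub_zero[OF span] by simp
  next
    case (step k)
    define a' where "a' = a(k := 0)"
    have aA: "a \<in> carrier A" using step.prems by (simp add: A_ideal_mem)
    then have ak: "a k \<in> Zloc p" by (simp add: A_ring_simps)
    have a': "a' \<in> A_ideal p q (Suc k)"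
      using step.prems p by (auto simp: A_ideal_mem A_ring_simps a'_def Zloc_0 less_Suc_eq)
    have "a = A_const (a k) \<otimes>\<^bsub>A\<^esub> Phi k \<oplus>\<^bsub>A\<^esub> a'"
      by (auto simp: A_ring_simps A_mult_const Phi_def a'_def)
    moreover have "a' \<in> carrier A" using a' by (simp add: A_ideal_mem)
    ultimately have "a \<odot> x = scale (a k) (Phi k \<odot> x) \<oplus> a' \<odot> x"
      using x ak A_const_closed Phi_closed by (metis R.m_closed smult_l_distr smult_assoc1)
    moreover have "Phi k \<odot> x \<in> Zspan ?S"
      using Zspan_superset[OF _ SM] step.hyps by auto
    ultimately show ?case
      using step.IH[OF a'] span ak by (simp add: Zsub_add Zsub_scale)
  qed
  from this[of _ 0] have "cyclic_sub p q M x \<subseteq> Zspan ?S"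
    by (auto simp: cyclic_sub_def A_ideal_mem)
  then show "cyclic_sub p q M x = Zspan ?S"
    using Zspan_least[OF _ Zsub_cyclic[OF x] sub] by auto
qed

section \<open>The filtration p^e Ax and continuity of the action\<close>

definition pdiv :: "'b \<Rightarrow> nat \<Rightarrow> 'b set" where
  "pdiv x e = {scale (of_nat p ^ e) z | z. z \<in> cyclic_sub p q M x}"

lemma pdiv_add: "x \<in> carrier M \<Longrightarrow> y \<in> pdiv x e \<Longrightarrow> z \<in> pdiv x e \<Longrightarrow> y \<oplus> z \<in> pdiv x e"
proof -
  assume x: "x \<in> carrier M" and "y \<in> pdiv x e" "z \<in> pdiv x e"
  then obtain y' z' where *: "y' \<in> cyclic_sub p q M x" "z' \<in> cyclic_sub p q M x"
      "y = scale (of_nat p ^ e) y'" "z = scale (of_nat p ^ e) z'"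
    by (auto simp: pdiv_def)
  note N = Zsub_cyclic[OF x]
  have "y \<oplus> z = scale (of_nat p ^ e) (y' \<oplus> z')"
    using * Zloc_of_nat_power[OF p] by (simp add: scale_add_right Zsub_carrier[OF N])
  then show ?thesis using Zsub_add[OF N] * unfolding pdiv_def by blast
qed

lemma pdiv_smult: "x \<in> carrier M \<Longrightarrow> a \<in> carrier A \<Longrightarrow> y \<in> pdiv x e \<Longrightarrow> a \<odot> y \<in> pdiv x e"
proof -
  assume *: "x \<in> carrier M" "a \<in> carrier A" "y \<in> pdiv x e"
  then obtain b where b: "b \<in> carrier A" "y = scale (of_nat p ^ e) (b \<odot> x)"
    by (auto simp: pdiv_def cyclic_sub_def)
  then have "a \<odot> y = scale (of_nat p ^ e) ((a \<otimes>\<^bsub>A\<^esub> b) \<odot> x)"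
    using * Zloc_of_nat_power[OF p] by (simp add: smult_scale smult_assoc1)
  then show ?thesis using b * smult_in_cyclic[of "a \<otimes>\<^bsub>A\<^esub> b" x] unfolding pdiv_def by blast
qed

text \<open>Dividing all coefficients of b - a by p^e at once yields an element w of
  \<open>A\<close>, so the congruence becomes the finite identity b = a + p^e w.\<close>

lemma pdiv_cong:
  assumes x: "x \<in> carrier M" and ab: "a \<in> carrier A" "b \<in> carrier A"
    and cong: "\<And>k. b k - a k \<in> Zideal p e" and a: "a \<odot> x \<in> pdiv x e"
  shows "b \<odot> x \<in> pdiv x e"
proof -
  have "\<exists>w. w \<in> Zloc p \<and> b k - a k = of_nat p ^ e * w" for k
    using cong[of k] by (auto simp: Zideal_def)
  then obtain w where w: "\<And>k. w k \<in> Zloc p" "\<And>k. b k - a k = of_nat p ^ e * w k"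
    by metis
  have wA: "w \<in> carrier A" using w by (simp add: A_ring_simps)
  have "b = a \<oplus>\<^bsub>A\<^esub> A_const (of_nat p ^ e) \<otimes>\<^bsub>A\<^esub> w"
    by (auto simp: A_ring_simps A_mult_const simp flip: w(2))
  then have "b \<odot> x = a \<odot> x \<oplus> scale (of_nat p ^ e) (w \<odot> x)"
    using x ab(1) wA A_const_closed[OF Zloc_of_nat_power[OF p, of e]]
    by (simp add: smult_l_distr smult_assoc1)
  moreover have "scale (of_nat p ^ e) (w \<odot> x) \<in> pdiv x e"
    using smult_in_cyclic[OF wA] by (auto simp: pdiv_def)
  ultimately show ?thesis using pdiv_add[OF x a] by simp
qed

text \<open>Shifting preserves coefficientwise congruences, so errors do not grow under iteration.
  The induction needs arbitrary \<open>b\<close>, since its hypothesis is applied to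
  \<open>Phi P\<close> times \<open>b\<close>.\<close>

lemma power_Phi_shift:
  assumes P: "\<And>i. qseq q (P + i) - qseq q i \<in> Zideal p e" and "b \<in> carrier A"
  shows "(Phi P [^]\<^bsub>A\<^esub> (i::nat) \<otimes>\<^bsub>A\<^esub> b) k - shift (i * P) b k \<in> Zideal p e"
  using assms(2)
proof (induction i arbitrary: b k)
  case 0
  then show ?case using p by (simp add: shift_def Zideal_0)
next
  case (Suc i)
  let ?b = "Phi P \<otimes>\<^bsub>A\<^esub> b"
  have b: "?b \<in> carrier A" using Suc.prems Phi_closed by simp
  have eq: "Phi P [^]\<^bsub>A\<^esub> Suc i \<otimes>\<^bsub>A\<^esub> b = Phi P [^]\<^bsub>A\<^esub> i \<otimes>\<^bsub>A\<^esub> ?b"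
    using Suc.prems Phi_closed by (simp add: R.m_assoc)
  have "?b j - shift P b j \<in> Zideal p e" for j
    using A_mult_Phi_shift[OF p q P] Suc.prems by (simp add: A_ring_simps)
  then have "shift (i * P) ?b k - shift (i * P) (shift P b) k \<in> Zideal p e"
    using p by (auto simp: shift_def[of "i * P"] Zideal_0)
  moreover have "shift (i * P) (shift P b) k = shift (Suc i * P) b k"
    by (auto simp: shift_def algebra_simps)
  ultimately have "shift (i * P) ?b k - shift (Suc i * P) b k \<in> Zideal p e" by simp
  from Zideal_add[OF p Suc.IH[OF b, of k] this] show ?case
    unfolding eq by simp
qed

text \<open>Modulo \<open>p ^ e\<close>, multiplication by \<open>u = Phi P\<close> is a shift when \<open>P\<close> is a period of
  \<open>qseq q\<close>. As \<open>Ax / p ^ e Ax\<close> is finite, \<open>u ^ i\<close> and \<open>u ^ j\<close> agree there for some \<open>i < j\<close>,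
  and \<open>g\<close>, the sum of all \<open>u ^ (r * (j - i))\<close>, inverts \<open>1 - u ^ (j - i)\<close>. Hence \<open>u ^ i\<close> kills
  \<open>x\<close> modulo \<open>p ^ e\<close>, and so do its multiples, the members of \<open>A_ideal p q (i * P)\<close>.\<close>

lemma A_ideal_pdiv:
  assumes x: "x \<in> carrier M" and S: "finite S" "S \<subseteq> carrier M" and N: "cyclic_sub p q M x = Zspan S"
  obtains m where "\<And>a. a \<in> A_ideal p q m \<Longrightarrow> a \<odot> x \<in> pdiv x e"
proof -
  obtain P where P: "P > 0" "\<And>i. qseq q (P + i) - qseq q i \<in> Zideal p e"
    using qseq_period[OF p q] by blast
  let ?u = "\<lambda>i::nat. Phi P [^]\<^bsub>A\<^esub> i"
  have u: "?u i \<in> carrier A" for i using Phi_closed by simp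
  obtain F where F: "finite F" "F \<subseteq> Zspan S"
      "\<And>y. y \<in> Zspan S \<Longrightarrow> \<exists>f\<in>F. \<exists>z\<in>Zspan S. y = f \<oplus> scale (of_nat p ^ e) z"
    using Zspan_finite_index[OF S, of e] by blast
  have "\<exists>f\<in>F. \<exists>z\<in>Zspan S. ?u i \<odot> x = f \<oplus> scale (of_nat p ^ e) z" for i
    using F(3) smult_in_cyclic[OF u] N by blast
  then obtain f z where fz: "\<And>i. f i \<in> F" "\<And>i. z i \<in> cyclic_sub p q M x"
      "\<And>i. ?u i \<odot> x = f i \<oplus> scale (of_nat p ^ e) (z i)"
    unfolding N by metis
  have "\<not> inj f"
    using F(1) fz(1) by (metis finite_imageD finite_subset image_subsetI infinite_UNIV_nat)
  then obtain i j where ij: "i < j" "f i = f j"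
    unfolding inj_def by (metis nat_neq_iff)
  define a where "a = ?u i \<ominus>\<^bsub>A\<^esub> ?u j"
  have aA: "a \<in> carrier A" using u by (simp add: a_def)
  have NM: "y \<in> carrier M" if "y \<in> cyclic_sub p q M x" for y
    using Zsub_carrier[OF Zsub_cyclic[OF x] that] .
  have fM: "f i \<in> carrier M" using fz(1) F(2) NM N by blast
  have sM: "scale (of_nat p ^ e) (z k) \<in> carrier M" for k
    using NM fz(2) Zloc_of_nat_power[OF p] by (simp add: scale_closed)
  have neg: "(- 1 :: rat) \<in> Zloc p" using Zloc_of_int[OF p, of "-1"] by simp
  have "a \<odot> x = ?u i \<odot> x \<oplus> \<ominus> (?u j \<odot> x)"
    using u x by (simp add: a_def a_minus_def smult_l_distr smult_l_minus)
  also have "\<dots> = scale (of_nat p ^ e) (z i) \<oplus> \<ominus> scale (of_nat p ^ e) (z j)"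
    using fM sM ij(2) unfolding fz(3) by (simp add: M.minus_add M.a_ac M.r_neg1 M.r_neg2)
  also have "\<dots> \<in> pdiv x e"
  proof (rule pdiv_add[OF x])
    have zp: "scale (of_nat p ^ e) (z k) \<in> pdiv x e" for k using fz(2) by (auto simp: pdiv_def)
    then show "scale (of_nat p ^ e) (z i) \<in> pdiv x e" .
    show "\<ominus> scale (of_nat p ^ e) (z j) \<in> pdiv x e"
      using pdiv_smult[OF x A_const_closed[OF neg] zp] sM by (simp only: scale_uminus)
  qed
  finally have a: "a \<odot> x \<in> pdiv x e" .
  \<comment> \<open>The length of the shift performed by u^(j-i) modulo p^e.\<close>
  define l where "l = (j - i) * P"
  have l: "l > 0" "j * P = i * P + l"
    using ij(1) P(1) by (auto simp: l_def algebra_simps simp flip: add_mult_distrib)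
  \<comment> \<open>Modulo p^e, u^(r(j-i)) is the basis element of index r l, so the geometric
    series has coefficient 1 exactly at the multiples of l. Giving the sequence outright avoids any
    limit.\<close>
  define g where "g k = (if l dvd k then 1 else 0 :: rat)" for k
  have gA: "g \<in> carrier A" using p by (simp add: A_ring_simps g_def Zloc_0 Zloc_1)
  have ui: "?u i \<odot> x \<in> pdiv x e"
  proof (rule pdiv_cong[OF x _ u])
    show "a \<otimes>\<^bsub>A\<^esub> g \<in> carrier A" using aA gA by simp
    have "(a \<otimes>\<^bsub>A\<^esub> g) \<odot> x = g \<odot> (a \<odot> x)" using aA gA x by (simp add: R.m_comm[of a g] smult_assoc1)
    then show "(a \<otimes>\<^bsub>A\<^esub> g) \<odot> x \<in> pdiv x e" using pdiv_smult[OF x gA a] by simp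
    fix k
    have "a \<otimes>\<^bsub>A\<^esub> g = ?u i \<otimes>\<^bsub>A\<^esub> g \<ominus>\<^bsub>A\<^esub> ?u j \<otimes>\<^bsub>A\<^esub> g"
      using u gA by (simp add: a_def a_minus_def R.l_distr R.l_minus)
    then have ag: "(a \<otimes>\<^bsub>A\<^esub> g) k = (?u i \<otimes>\<^bsub>A\<^esub> g) k - (?u j \<otimes>\<^bsub>A\<^esub> g) k"
      using u gA by (simp add: A_minus)
    have one: "?u i k - shift (i * P) (\<one>\<^bsub>A\<^esub>) k \<in> Zideal p e"
      using power_Phi_shift[OF P(2) R.one_closed, of i k] unfolding R.r_one[OF u] .
    \<comment> \<open>Telescoping of the geometric series: subtracting its shift by l leaves
      1.\<close>
    have one_eq: "A_const 1 n = g n - (if n < l then 0 else g (n - l))" for n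
    proof (cases "n < l")
      case True
      then show ?thesis by (auto simp: A_const_def g_def dest: dvd_imp_le)
    next
      case False
      then have "l dvd n - l \<longleftrightarrow> l dvd n" by (simp add: dvd_minus_self)
      with False l(1) show ?thesis by (simp add: A_const_def g_def)
    qed
    have "shift (i * P) (\<one>\<^bsub>A\<^esub>) k = shift (i * P) g k - shift (j * P) g k"
    proof (cases "k < i * P")
      case True
      then have "k < j * P" using l(2) by linarith
      with True show ?thesis by (simp add: shift_def)
    next
      case False
      then have "k < j * P \<longleftrightarrow> k - i * P < l" "k - j * P = k - i * P - l"
        using l(2) by linarith+
      with False show ?thesis
        unfolding shift_def A_ring_simps one_eq by simp
    qed
    then have "?u i k - (a \<otimes>\<^bsub>A\<^esub> g) k = (?u i k - shift (i * P) (\<one>\<^bsub>A\<^esub>) k) -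
        ((?u i \<otimes>\<^bsub>A\<^esub> g) k - shift (i * P) g k) + ((?u j \<otimes>\<^bsub>A\<^esub> g) k - shift (j * P) g k)"
      using ag by simp
    then show "?u i k - (a \<otimes>\<^bsub>A\<^esub> g) k \<in> Zideal p e"
      using Zideal_add[OF p Zideal_diff[OF p one power_Phi_shift[OF P(2) gA, of i k]]
          power_Phi_shift[OF P(2) gA, of j k]] by (simp only:)
  qed
  show thesis
  proof (rule that)
    fix b assume b: "b \<in> A_ideal p q (i * P)"
    \<comment> \<open>Stripping the i P leading zeros exhibits b, modulo p^e, as u^i times an
      element of \<open>A\<close>.\<close>
    define b' where "b' k = b (k + i * P)" for k
    have bA: "b \<in> carrier A" "b' \<in> carrier A"
      using b by (auto simp: A_ideal_mem A_ring_simps b'_def)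
    have "shift (i * P) b' = b"
      using b by (auto simp: shift_def b'_def A_ideal_mem)
    then have "b k - (?u i \<otimes>\<^bsub>A\<^esub> b') k \<in> Zideal p e" for k
      using Zideal_uminus[OF p power_Phi_shift[OF P(2) bA(2), of i k]] by simp
    moreover have "(?u i \<otimes>\<^bsub>A\<^esub> b') \<odot> x = b' \<odot> (?u i \<odot> x)"
      using u bA x by (simp add: R.m_comm[of _ b'] smult_assoc1)
    then have "(?u i \<otimes>\<^bsub>A\<^esub> b') \<odot> x \<in> pdiv x e" using pdiv_smult[OF x bA(2) ui] by simp
    ultimately show "b \<odot> x \<in> pdiv x e"
      using pdiv_cong[OF x _ bA(1)] u bA by blast
  qed
qed

text \<open>If no \<open>A_ideal p q n\<close> annihilates \<open>x\<close>, there are \<open>b i\<close> in ideals \<open>A_ideal p q (\<nu> i)\<close> of rapidly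
  increasing index such that the sums of the subfamilies of \<open>b\<close> act differently on \<open>x\<close>. This
  contradicts the countability of \<open>Ax\<close>.\<close>

lemma fg_imp_annihilated:
  assumes x: "x \<in> carrier M" and S: "finite S" "S \<subseteq> carrier M" and N: "cyclic_sub p q M x = Zspan S"
  shows "\<exists>n. \<forall>a\<in>A_ideal p q n. a \<odot> x = \<zero>"
proof (rule ccontr)
  assume "\<not> ?thesis"
  then have ex: "\<exists>a\<in>A_ideal p q n. a \<odot> x \<noteq> \<zero>" for n by blast
  \<comment> \<open>Separation provides an e that detects a x as nonzero; continuity provides an m
    such that adding members of A_m to a cannot spoil this.\<close>
  have "\<exists>a e m. a \<in> A_ideal p q n \<and> a \<odot> x \<notin> pdiv x e \<and> (\<forall>b\<in>A_ideal p q m. b \<odot> x \<in> pdiv x e)" for n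
  proof -
    obtain a where a: "a \<in> A_ideal p q n" "a \<odot> x \<noteq> \<zero>" using ex by blast
    then obtain e where e: "a \<odot> x \<notin> pdiv x e"
      using Zspan_separated[OF S, of "a \<odot> x"] unfolding pdiv_def N by blast
    then show ?thesis using A_ideal_pdiv[OF x S N, of e] a(1) by metis
  qed
  then obtain B E m where B: "\<And>n. B n \<in> A_ideal p q n" "\<And>n. B n \<odot> x \<notin> pdiv x (E n)"
      "\<And>n b. b \<in> A_ideal p q (m n) \<Longrightarrow> b \<odot> x \<in> pdiv x (E n)"
    by metis
  have m: "n < m n" for n
  proof (rule ccontr)
    assume "\<not> n < m n"
    then have "B n \<in> A_ideal p q (m n)" using B(1)[of n] by (auto simp: A_ideal_mem)
    then show False using B(2,3) by blast
  qed
  \<comment> \<open>Taking m of the previous index as the next one makes every later choice act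
    within the subgroup p^e Ax used to detect each earlier choice.\<close>
  define \<nu> where "\<nu> = rec_nat 0 (\<lambda>_. m)"
  have \<nu>_Suc: "\<nu> (Suc i) = m (\<nu> i)" for i by (simp add: \<nu>_def)
  have mono: "strict_mono \<nu>" using m by (simp add: strict_mono_Suc_iff \<nu>_Suc)
  let ?b = "\<lambda>i. B (\<nu> i)"
  have b_eq_0: "?b i k = 0" if "k < \<nu> i" for i k
    using B(1)[of "\<nu> i"] that by (simp add: A_ideal_mem)
  have b: "?b i \<in> carrier A" for i using B(1) by (simp add: A_ideal_mem)
  \<comment> \<open>The sum of the b_i with i in X. As \<open>\<nu> i\<close> is at least i, b_i has
    k-th coefficient 0 for i > k, so this finite sum loses nothing.\<close>
  define F where "F X k = (\<Sum>i\<in>X \<inter> {..k}. ?b i k)" for X k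
  have FA: "F X \<in> carrier A" for X
    using b
    by (auto simp: A_ring_simps F_def intro!: Zideal_sum[OF p, of _ _ 0, unfolded Zideal_zero_exp])
  have differ: "F X \<odot> x \<noteq> F Y \<odot> x"
    if i: "i \<in> X" "i \<notin> Y" and below: "\<And>j. j < i \<Longrightarrow> j \<in> X \<longleftrightarrow> j \<in> Y" for X Y i
  proof
    assume eq: "F X \<odot> x = F Y \<odot> x"
    define d where "d = (F X \<ominus>\<^bsub>A\<^esub> F Y)"
    have dA: "d \<in> carrier A" unfolding d_def using FA FA by (rule R.minus_closed)
    have d: "d k = F X k - F Y k" for k unfolding d_def A_minus[OF FA FA] ..
    have F_low: "F Z k = (\<Sum>j\<in>Z \<inter> {..<i}. ?b j k) + (if i \<in> Z then ?b i k else 0)"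
      if "k < \<nu> (Suc i)" for Z k
    proof -
      have zero: "?b j k = 0" if "j > i \<or> j > k" for j
      proof -
        have "k < \<nu> j"
          using that
        proof
          assume "j > i"
          then have "\<nu> (Suc i) \<le> \<nu> j" using mono by (simp add: strict_mono_less_eq)
          then show ?thesis using \<open>k < \<nu> (Suc i)\<close> by simp
        next
          assume "j > k"
          then show ?thesis using strict_mono_imp_increasing[OF mono, of j] by simp
        qed
        then show ?thesis by (rule b_eq_0)
      qed
      \<comment> \<open>Neither i nor k need be the larger; terms beyond either bound vanish, so
        both truncations equal the one at the maximum.\<close>
      have "F Z k = (\<Sum>j\<in>Z \<inter> {..max i k}. ?b j k)"
        unfolding F_def by (intro sum.mono_neutral_left) (auto intro!: zero)
      also have "\<dots> = (\<Sum>j\<in>Z \<inter> {..i}. ?b j k)"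
        by (intro sum.mono_neutral_right) (auto intro!: zero)
      also have "Z \<inter> {..i} = Z \<inter> {..<i} \<union> (if i \<in> Z then {i} else {})" by (auto simp: less_le)
      also have "(\<Sum>j\<in>\<dots>. ?b j k) = (\<Sum>j\<in>Z \<inter> {..<i}. ?b j k) + (if i \<in> Z then ?b i k else 0)"
        by (subst sum.union_disjoint) auto
      finally show ?thesis .
    qed
    have XY: "X \<inter> {..<i} = Y \<inter> {..<i}" using below by auto
    have low: "d k = ?b i k" if "k < \<nu> (Suc i)" for k
      using i unfolding d F_low[OF that] XY by simp
    \<comment> \<open>The difference acts within the subgroup that b_i x avoids, while d acts as
      zero; together these would put b_i x into it.\<close>
    have "d \<ominus>\<^bsub>A\<^esub> ?b i \<in> A_ideal p q (m (\<nu> i))"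
      unfolding A_ideal_mem
    proof (intro conjI allI impI)
      show "d \<ominus>\<^bsub>A\<^esub> ?b i \<in> carrier A" using dA b by (rule R.minus_closed)
      show "(d \<ominus>\<^bsub>A\<^esub> ?b i) k = 0" if "k < m (\<nu> i)" for k
        using low[of k] that by (simp only: A_minus[OF dA b] \<nu>_Suc diff_self)
    qed
    then have "(d \<ominus>\<^bsub>A\<^esub> ?b i) \<odot> x \<in> pdiv x (E (\<nu> i))" by (rule B(3))
    moreover have "d \<odot> x = \<zero>"
      using eq FA x by (simp add: d_def a_minus_def smult_l_distr smult_l_minus M.r_neg)
    ultimately have "\<ominus> (?b i \<odot> x) \<in> pdiv x (E (\<nu> i))"
      using dA b x by (simp add: a_minus_def smult_l_distr smult_l_minus)
    then have "scale (- 1) (\<ominus> (?b i \<odot> x)) \<in> pdiv x (E (\<nu> i))"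
      using pdiv_smult[OF x A_const_closed] Zloc_of_int[OF p, of "-1"] by simp
    then show False using B(2) b x by (simp add: scale_uminus)
  qed
  have "inj (\<lambda>X. F X \<odot> x)"
  proof (rule injI, rule ccontr)
    fix X Y :: "nat set"
    assume eq: "F X \<odot> x = F Y \<odot> x" and "X \<noteq> Y"
    define i where "i = (LEAST i. i \<in> X \<longleftrightarrow> i \<notin> Y)"
    have "\<exists>i. i \<in> X \<longleftrightarrow> i \<notin> Y" using \<open>X \<noteq> Y\<close> by blast
    then have i: "i \<in> X \<longleftrightarrow> i \<notin> Y" unfolding i_def by (rule LeastI_ex)
    have "j \<in> X \<longleftrightarrow> j \<in> Y" if "j < i" for j
      using not_less_Least[of j "\<lambda>i. i \<in> X \<longleftrightarrow> i \<notin> Y"] that by (auto simp: i_def)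
    then show False using differ[of i X Y] differ[of i Y X] i eq by metis
  qed
  moreover have "countable (range (\<lambda>X. F X \<odot> x))"
  proof (rule countable_subset)
    show "range (\<lambda>X. F X \<odot> x) \<subseteq> Zspan S" using smult_in_cyclic[OF FA] N by blast
    show "countable (Zspan S)" using S by (rule countable_Zspan)
  qed
  ultimately have "countable (UNIV :: nat set set)" by (rule countable_image_inj_on[rotated])
  \<comment> \<open>An injection of the power set of the naturals into the naturals would have an
    inverse onto that power set, against Cantor.\<close>
  then obtain f :: "nat set \<Rightarrow> nat" where f: "inj f" by (auto simp: countable_def)
  then have "surj (inv_into UNIV f)" by (rule inj_imp_surj_inv)
  then have "range (inv_into UNIV f) = Pow UNIV" by simp
  then show False using Cantors_theorem[of UNIV] by blast
qed

end

theorem theorem3p2: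
  fixes p :: nat and q :: int and M :: "((nat \<Rightarrow> rat), 'b) module"
  assumes "prime p" and "odd p" and "primitive_mod_sq p q"
    and "Module.module (A_ring p q) M"
  shows "discrete_mod p q M \<longleftrightarrow> locally_fg p q M"
proof -
  interpret A_module p q M
    using assms by (intro A_module.intro A_module_axioms.intro) (auto simp: primitive_mod_sq_def)
  have fg_iff: "locally_fg p q M \<longleftrightarrow> (\<forall>x\<in>carrier M. \<exists>S. finite S \<and>
      S \<subseteq> cyclic_sub p q M x \<and> cyclic_sub p q M x = Zspan S)"
    by (simp only: locally_fg_def Zspan_def)
  show ?thesis
    unfolding discrete_mod_def fg_iff
  proof (rule ball_cong[OF refl], rule iffI)
    fix x assume x: "x \<in> carrier M"
    show "\<exists>S. finite S \<and> S \<subseteq> cyclic_sub p q M x \<and> cyclic_sub p q M x = Zspan S"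
      if "\<exists>n. \<forall>a\<in>A_ideal p q n. a \<odot>\<^bsub>M\<^esub> x = \<zero>\<^bsub>M\<^esub>"
      using that annihilated_imp_fg[OF x] by (elim exE)
    show "\<exists>n. \<forall>a\<in>A_ideal p q n. a \<odot>\<^bsub>M\<^esub> x = \<zero>\<^bsub>M\<^esub>"
      if fg: "\<exists>S. finite S \<and> S \<subseteq> cyclic_sub p q M x \<and> cyclic_sub p q M x = Zspan S"
    proof -
      obtain S where S: "finite S" "S \<subseteq> cyclic_sub p q M x" "cyclic_sub p q M x = Zspan S"
        using fg by (elim exE conjE)
      have "S \<subseteq> carrier M" using S(2) Zsub_carrier[OF Zsub_cyclic[OF x]] by (rule subset_trans[OF _ subsetI])
      then show ?thesis using S(1,3) by (intro fg_imp_annihilated[OF x])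
    qed
  qed
qed

end
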